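(* (i) Let $m$ be a positive integer and $p$ a prime dividing $m$. Then $$\binom{m+p}{p}\not\equiv 1 \pmod{m}.$$ (ii) If in addition $r\ge 1$ is an integer with $p^r\mid m$ but $p^{r+1}\nmid m$, then $$\binom{m+p}{p}\equiv \frac{m}{p}+1\not\equiv 1 \pmod{p^r}.$$ *)

theory Defs
  imports "HOL-Number_Theory.Cong"
begin

end

theory Submission
  imports Defs
begin

text \<open>
  Writing \<open>(m + p choose p) = (m / p + 1) * (m + p - 1 choose p - 1)\<close>, the second factor is
  \<open>1\<close> modulo \<open>p ^ r\<close>: multiplied by \<open>(p - 1)!\<close>, a unit modulo \<open>p ^ r\<close>, it becomes the product
  of the \<open>m + i\<close> with \<open>0 < i < p\<close>, which is \<open>(p - 1)!\<close> modulo \<open>m\<close>. Finally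
  \<open>m / p\<close> is nonzero modulo the exact power of \<open>p\<close> dividing \<open>m\<close>, which also yields (i).
\<close>

text \<open>The left side is the product of the \<open>m + i\<close> with
  \<open>1 \<le> i \<le> k\<close>. The factor \<open>fact k\<close> stays on both sides because it
  need not be invertible modulo \<open>m\<close>.\<close>

lemma cong_binomial_add_mult_fact:
  fixes m k :: nat
  shows "[(m + k choose k) * fact k = fact k] (mod m)"
proof (induction k)
  case 0
  show ?case by simp
next
  case (Suc k)
  have "(m + Suc k choose Suc k) * fact (Suc k) = (Suc (m + k) choose Suc k) * Suc k * fact k"
    by (simp only: add_Suc_right fact_Suc of_nat_id mult.assoc)
  also have "\<dots> = Suc (m + k) * ((m + k choose k) * fact k)"
    by (simp only: Suc_times_binomial_eq [symmetric] mult.assoc)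
  also have "[\<dots> = Suc k * fact k] (mod m)"
    by (intro cong_mult Suc) (simp add: cong_def flip: add_Suc_right)
  finally show ?case
    by simp
qed

lemma cong_binomial_add_prime:
  fixes m p r :: nat
  assumes "prime p" and "p dvd m" and "p ^ r dvd m"
  shows "[(m + p) choose p = m div p + 1] (mod p ^ r)"
proof -
  obtain k where p: "p = Suc k"
    using prime_gt_0_nat [OF \<open>prime p\<close>] gr0_implies_Suc by blast
  obtain q where m: "m = p * q"
    using \<open>p dvd m\<close> by blast
  \<comment> \<open>As \<open>k = p - 1\<close>, every factor of \<open>fact k\<close> is below
    \<open>p\<close>.\<close>
  have "coprime (fact k) (p ^ r)"
    using \<open>prime p\<close> p
    by (metis coprime_commute coprime_power_right_iff lessI linorder_not_less
        prime_dvd_fact_iff prime_imp_coprime)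
  moreover have "[(m + k choose k) * fact k = 1 * fact k] (mod p ^ r)"
    using cong_dvd_modulus_nat [OF cong_binomial_add_mult_fact \<open>p ^ r dvd m\<close>] by simp
  ultimately have unit: "[m + k choose k = 1] (mod p ^ r)"
    using cong_mult_rcancel_nat by blast
  \<comment> \<open>Absorption identity, with \<open>Suc (m + k) = m + p = p * (q + 1)\<close>; the
    common factor \<open>p\<close> is cancelled next.\<close>
  have "p * ((m + p) choose p) = p * ((q + 1) * (m + k choose k))"
    using Suc_times_binomial_eq [of "m + k" k] by (simp add: p m algebra_simps)
  then have "(m + p) choose p = (m div p + 1) * (m + k choose k)"
    using prime_gt_0_nat [OF \<open>prime p\<close>] by (simp add: m del: binomial_Suc_Suc)
  then show ?thesis
    using cong_scalar_left [OF unit, of "m div p + 1"] by simp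
qed

text \<open>Otherwise \<open>p ^ r\<close> divides \<open>m div p\<close>, and multiplying by
  \<open>p\<close> contradicts the second assumption.\<close>

lemma not_cong_div_prime_add_one:
  fixes m p r :: nat
  assumes "p dvd m" and "\<not> p ^ (r + 1) dvd m"
  shows "\<not> [m div p + 1 = 1] (mod p ^ r)"
proof
  assume "[m div p + 1 = 1] (mod p ^ r)"
  then have "p ^ r dvd m div p"
    by (metis add_0 cong_0_iff cong_add_rcancel_nat)
  then have "p * p ^ r dvd p * (m div p)"
    by (rule mult_dvd_mono [OF dvd_refl])
  with assms show False
    by simp
qed

theorem theorem4:
  fixes m p :: nat
  assumes "m > 0" and "prime p" and "p dvd m"
  shows "\<not> [(m + p) choose p = 1] (mod m)
    \<and> (\<forall>r\<ge>1. p ^ r dvd m \<and> \<not> p ^ (r + 1) dvd m \<longrightarrow>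
          [(m + p) choose p = m div p + 1] (mod p ^ r)
          \<and> \<not> [m div p + 1 = 1] (mod p ^ r))"
proof (intro conjI allI impI)
  \<comment> \<open>Part (i) reduces to this exact exponent, since a congruence modulo
    \<open>m\<close> descends to \<open>p ^ r\<close>.\<close>
  define r where "r = multiplicity p m"
  have r: "p ^ r dvd m" "\<not> p ^ (r + 1) dvd m"
    using power_dvd_iff_le_multiplicity [of m p "r + 1"] assms(1) prime_gt_1_nat [OF assms(2)]
    by (auto simp: r_def multiplicity_dvd)
  show "\<not> [(m + p) choose p = 1] (mod m)"
  proof
    assume "[(m + p) choose p = 1] (mod m)"
    then have "[(m + p) choose p = 1] (mod p ^ r)"
      using r(1) cong_dvd_modulus_nat by blast
    then show False
      using cong_binomial_add_prime [OF assms(2,3) r(1)] not_cong_div_prime_add_one [OF assms(3) r(2)]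
      by (metis cong_sym cong_trans)
  qed
qed (use assms cong_binomial_add_prime not_cong_div_prime_add_one in blast)+

end
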